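(* Let $G$ be a (multiplicatively written) Polish group and let $A \subseteq G$ be an EBP-set of $G$ which is not residually null. Then both $A^{-1}A = \{a^{-1}b : a,b \in A\}$ and $AA^{-1} = \{ab^{-1} : a,b\in A\}$ contain a neighborhood of the identity of $G$.
   Context: A Polish group is a topological group whose topology is Polish (separable and completely metrizable). For a Polish space $X$, $\mathcal{M}(X)$ is the set of all Borel probability measures on $X$ with the coarsest topology for which each map $\mu \mapsto \int f\,d\mu$, with $f : X \to \mathbb{R}$ bounded and continuous, is continuous ($\mathcal M(X)$ is then Polish). For $A \subseteq X$, $\mathcal{N}(A) = \{\mu \in \mathcal{M}(X) : \mu^*(A) = 0\}$, where $\mu^*$ is the outer measure induced by $\mu$. $A$ is residually null if $\mathcal{N}(A)$ is co-meager in $\mathcal{M}(X)$. $A$ is an EBP-set of $X$ if there is an open set $U \subseteq X$ such that $U \triangle A$ (symmetric difference) is residually null. *)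

theory Defs
  imports "HOL-Algebra.Group" "HOL-Probability.Probability_Measure"
begin

definition polish_topology :: "'a topology \<Rightarrow> bool" where
  "polish_topology T \<longleftrightarrow> separable_space T \<and> completely_metrizable_space T"

locale topological_group = group G for G (structure) +
  fixes T :: "'a topology"
  assumes topspace_eq_carrier: "topspace T = carrier G"
    and continuous_mult: "continuous_map (prod_topology T T) T (\<lambda>(x, y). x \<otimes> y)"
    and continuous_inv: "continuous_map T T (\<lambda>x. inv x)"

locale polish_group = topological_group +
  assumes polish: "polish_topology T"

definition nowhere_dense_in :: "'a topology \<Rightarrow> 'a set \<Rightarrow> bool" where
  "nowhere_dense_in T S \<longleftrightarrow> S \<subseteq> topspace T \<and> T interior_of (T closure_of S) = {}"

definition meager_in :: "'a topology \<Rightarrow> 'a set \<Rightarrow> bool" where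
  "meager_in T S \<longleftrightarrow>
     (\<exists>\<F>. countable \<F> \<and> (\<forall>F\<in>\<F>. nowhere_dense_in T F) \<and> S = \<Union>\<F>)"

definition comeager_in :: "'a topology \<Rightarrow> 'a set \<Rightarrow> bool" where
  "comeager_in T S \<longleftrightarrow> S \<subseteq> topspace T \<and> meager_in T (topspace T - S)"

definition borel_of :: "'a topology \<Rightarrow> 'a measure" where
  "borel_of T = sigma (topspace T) {U. openin T U}"

(* The measure space of such a \<mu> is determined by its sets (it is their union), so it
   need not be constrained separately. *)
definition borel_prob :: "'a topology \<Rightarrow> 'a measure set" where
  "borel_prob T = {\<mu>. prob_space \<mu> \<and> sets \<mu> = sets (borel_of T)}"

definition bounded_continuous_on :: "'a topology \<Rightarrow> ('a \<Rightarrow> real) \<Rightarrow> bool" where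
  "bounded_continuous_on T f \<longleftrightarrow> continuous_map T euclideanreal f \<and> bounded (f ` topspace T)"

(* The subbasis consists of the preimages of open sets under the maps \<mu> \<mapsto> \<integral>f d\<mu>, hence this is
   the coarsest topology making all of them continuous; taking V = UNIV gives the topspace. *)
definition weak_topology :: "'a topology \<Rightarrow> 'a measure topology" where
  "weak_topology T = topology_generated_by
     {{\<mu> \<in> borel_prob T. (\<integral>x. f x \<partial>\<mu>) \<in> V} |f V. bounded_continuous_on T f \<and> open V}"

lemma topspace_weak_topology [simp]: "topspace (weak_topology T) = borel_prob T"
proof -
  have "bounded_continuous_on T (\<lambda>_. 0)"
    by (auto simp: bounded_continuous_on_def image_constant_conv)
  then show ?thesis
    unfolding weak_topology_def topology_generated_by_topspace by blast
qed

definition null_measures :: "'a topology \<Rightarrow> 'a set \<Rightarrow> 'a measure set" where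
  "null_measures T A = {\<mu> \<in> borel_prob T. outer_measure_of \<mu> A = 0}"

definition residually_null :: "'a topology \<Rightarrow> 'a set \<Rightarrow> bool" where
  "residually_null T A \<longleftrightarrow> A \<subseteq> topspace T \<and> comeager_in (weak_topology T) (null_measures T A)"

definition EBP_set :: "'a topology \<Rightarrow> 'a set \<Rightarrow> bool" where
  "EBP_set T A \<longleftrightarrow>
     A \<subseteq> topspace T \<and> (\<exists>U. openin T U \<and> residually_null T ((U - A) \<union> (A - U)))"

definition contains_nhd :: "'a topology \<Rightarrow> 'a \<Rightarrow> 'a set \<Rightarrow> bool" where
  "contains_nhd T x S \<longleftrightarrow> (\<exists>V. openin T V \<and> x \<in> V \<and> V \<subseteq> S)"

end

theory Submission
  imports Defs
begin

text \<open>
  The residually null sets form a \<open>\<sigma>\<close>-ideal: \<open>\<N>\<close> turns countable unions into countable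
  intersections, and countable intersections of co-meager sets are co-meager.  A homeomorphism
  of spaces induces, by push-forward, a homeomorphism of the spaces of measures, so the ideal is
  invariant under homeomorphisms, in particular under the translations of the group.

  If a nonempty open set \<open>W\<close> were residually null, then so would be \<open>G\<close> itself, because by
  separability countably many translates of \<open>W\<close> cover \<open>G\<close>; then every subset of \<open>G\<close>, and
  in particular \<open>A\<close>, would be residually null.  Hence no nonempty open set is residually null.

  The rest is the classical argument of Steinhaus, Weil and Pettis.  Let \<open>U\<close> be open with
  \<open>U \<triangle> A\<close> residually null; \<open>U\<close> is nonempty since \<open>A\<close> is not residually null.  If \<open>h\<close> is
  a homeomorphism and \<open>A\<close> is disjoint from \<open>h(A)\<close>, then \<open>U \<inter> h(U)\<close> is contained in
  \<open>(U - A) \<union> h(U - A)\<close>; hence it is residually null, and being open it is empty.  For a fixed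
  \<open>u \<in> U\<close>, the set of those \<open>g\<close> with \<open>ug \<in> U\<close> is a neighborhood of the identity on which
  \<open>U\<close> meets \<open>Ug\<close>; so \<open>A\<close> meets \<open>Ag\<close>, which says \<open>g \<in> A\<inverse>A\<close>.  Left translations give
  \<open>AA\<inverse>\<close> in the same way.
\<close>

section \<open>Meager sets\<close>

lemma nowhere_dense_in_subset:
  assumes "nowhere_dense_in T S" "R \<subseteq> S"
  shows "nowhere_dense_in T R"
proof -
  have "T interior_of (T closure_of R) \<subseteq> T interior_of (T closure_of S)"
    by (intro interior_of_mono closure_of_mono assms)
  then show ?thesis
    using assms by (auto simp: nowhere_dense_in_def)
qed

lemma meager_in_subset:
  assumes "meager_in T S" "R \<subseteq> S"
  shows "meager_in T R"
proof -
  obtain \<F> where \<F>: "countable \<F>" "\<forall>F\<in>\<F>. nowhere_dense_in T F" "S = \<Union>\<F>"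
    using assms(1) by (auto simp: meager_in_def)
  have "R = \<Union>((\<lambda>F. F \<inter> R) ` \<F>)"
    using \<F>(3) assms(2) by blast
  moreover have "countable ((\<lambda>F. F \<inter> R) ` \<F>)"
    using \<F>(1) by simp
  moreover have "\<forall>F\<in>(\<lambda>F. F \<inter> R) ` \<F>. nowhere_dense_in T F"
    using \<F>(2) by (auto intro: nowhere_dense_in_subset)
  ultimately show ?thesis
    unfolding meager_in_def by blast
qed

lemma meager_in_UN:
  assumes "countable I" "\<And>i. i \<in> I \<Longrightarrow> meager_in T (S i)"
  shows "meager_in T (\<Union>i\<in>I. S i)"
proof -
  have "\<forall>i\<in>I. \<exists>\<F>. countable \<F> \<and> (\<forall>F\<in>\<F>. nowhere_dense_in T F) \<and> S i = \<Union>\<F>"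
    using assms(2) by (simp add: meager_in_def)
  then obtain \<F> where \<F>:
    "\<forall>i\<in>I. countable (\<F> i) \<and> (\<forall>F\<in>\<F> i. nowhere_dense_in T F) \<and> S i = \<Union>(\<F> i)"
    by metis
  have "countable (\<Union>i\<in>I. \<F> i)"
    using assms(1) \<F> by blast
  moreover have "\<forall>F\<in>(\<Union>i\<in>I. \<F> i). nowhere_dense_in T F"
    using \<F> by blast
  moreover have "(\<Union>i\<in>I. S i) = \<Union>(\<Union>i\<in>I. \<F> i)"
    using \<F> by auto
  ultimately show ?thesis
    unfolding meager_in_def by blast
qed

lemma meager_in_homeomorphic_image:
  assumes h: "homeomorphic_map S T h" and M: "meager_in S M"
  shows "meager_in T (h ` M)"
proof -
  have nd: "nowhere_dense_in T (h ` F)" if "nowhere_dense_in S F" for F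
  proof -
    from that have F: "F \<subseteq> topspace S" "S interior_of (S closure_of F) = {}"
      by (auto simp: nowhere_dense_in_def)
    have "T interior_of (T closure_of (h ` F)) = h ` (S interior_of (S closure_of F))"
      by (simp add: homeomorphic_map_closure_of[OF h F(1)]
          homeomorphic_map_interior_of[OF h closure_of_subset_topspace])
    moreover have "h ` F \<subseteq> topspace T"
      using F(1) homeomorphic_imp_surjective_map[OF h] by blast
    ultimately show ?thesis
      using F(2) by (simp add: nowhere_dense_in_def)
  qed
  obtain \<F> where \<F>: "countable \<F>" "\<forall>F\<in>\<F>. nowhere_dense_in S F" "M = \<Union>\<F>"
    using M by (auto simp: meager_in_def)
  have "countable ((`) h ` \<F>)" "\<forall>F\<in>(`) h ` \<F>. nowhere_dense_in T F" "h ` M = \<Union>((`) h ` \<F>)"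
    using \<F> nd by auto
  then show ?thesis
    unfolding meager_in_def by blast
qed

section \<open>Borel probability measures and their push-forwards\<close>

lemma space_borel_of: "space (borel_of T) = topspace T"
  and sets_borel_of: "sets (borel_of T) = sigma_sets (topspace T) {U. openin T U}"
  using openin_subset by (auto simp: borel_of_def space_measure_of_conv intro!: sets_measure_of)

lemma borel_probD:
  assumes "\<mu> \<in> borel_prob T"
  shows "prob_space \<mu>" "sets \<mu> = sets (borel_of T)" "space \<mu> = topspace T"
  using assms sets_eq_imp_space_eq[of \<mu> "borel_of T"] by (auto simp: borel_prob_def space_borel_of)

lemma measurable_borel_of:
  assumes "continuous_map S T h"
  shows "h \<in> borel_of S \<rightarrow>\<^sub>M borel_of T"
  unfolding borel_of_def[of T]
proof (rule measurable_measure_of)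
  show "{U. openin T U} \<subseteq> Pow (topspace T)"
    using openin_subset by blast
  show "h \<in> space (borel_of S) \<rightarrow> topspace T"
    using assms by (auto simp: space_borel_of continuous_map_def)
  fix U assume "U \<in> {U. openin T U}"
  then have "openin S {x \<in> topspace S. h x \<in> U}"
    using assms by (auto simp: continuous_map_def)
  moreover have "h -` U \<inter> space (borel_of S) = {x \<in> topspace S. h x \<in> U}"
    by (auto simp: space_borel_of)
  ultimately show "h -` U \<inter> space (borel_of S) \<in> sets (borel_of S)"
    by (auto simp: sets_borel_of)
qed

lemma borel_measurable_borel_of:
  assumes "continuous_map T euclidean f"
  shows "f \<in> borel_measurable (borel_of T)"
proof (rule borel_measurableI)
  fix V :: "'b set" assume "open V"
  then have "openin T {x \<in> topspace T. f x \<in> V}"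
    using assms by (auto simp: continuous_map_def)
  moreover have "f -` V \<inter> space (borel_of T) = {x \<in> topspace T. f x \<in> V}"
    by (auto simp: space_borel_of)
  ultimately show "f -` V \<inter> space (borel_of T) \<in> sets (borel_of T)"
    by (auto simp: sets_borel_of)
qed

definition push_forward :: "'b topology \<Rightarrow> ('a \<Rightarrow> 'b) \<Rightarrow> 'a measure \<Rightarrow> 'b measure" where
  "push_forward T h \<mu> = distr \<mu> (borel_of T) h"

lemma push_forward_measurable:
  assumes "continuous_map S T h" "\<mu> \<in> borel_prob S"
  shows "h \<in> \<mu> \<rightarrow>\<^sub>M borel_of T"
  using measurable_borel_of[OF assms(1)] borel_probD(2)[OF assms(2)]
  by (simp cong: measurable_cong_sets)

lemma push_forward_in_borel_prob:
  assumes "continuous_map S T h" "\<mu> \<in> borel_prob S"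
  shows "push_forward T h \<mu> \<in> borel_prob T"
  using prob_space.prob_space_distr[OF borel_probD(1)[OF assms(2)] push_forward_measurable[OF assms]]
  by (simp add: borel_prob_def push_forward_def)

lemma push_forward_inverse:
  assumes h: "homeomorphic_maps S T h k" and \<mu>: "\<mu> \<in> borel_prob S"
  shows "push_forward S k (push_forward T h \<mu>) = \<mu>"
proof -
  have c: "continuous_map S T h" "continuous_map T S k" and kh: "\<And>x. x \<in> topspace S \<Longrightarrow> k (h x) = x"
    using h by (auto simp: homeomorphic_maps_def)
  have "push_forward S k (push_forward T h \<mu>) = distr \<mu> (borel_of S) (k \<circ> h)"
    unfolding push_forward_def
    by (rule distr_distr[OF measurable_borel_of[OF c(2)] push_forward_measurable[OF c(1) \<mu>]])
  also have "\<dots> = distr \<mu> \<mu> (\<lambda>x. x)"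
    by (rule distr_cong) (use kh borel_probD[OF \<mu>] in auto)
  finally show ?thesis
    by simp
qed

text \<open>By change of variables, integrating \<open>f\<close> against \<open>h\<^sub>*\<mu>\<close> is integrating the bounded
  continuous function \<open>f \<circ> h\<close> against \<open>\<mu>\<close>, so subbasic open sets pull back to subbasic ones.\<close>

lemma continuous_map_push_forward:
  assumes h: "continuous_map S T h"
  shows "continuous_map (weak_topology S) (weak_topology T) (push_forward T h)"
  unfolding weak_topology_def[of T]
proof (rule continuous_on_generated_topo)
  fix U assume "U \<in> {{\<mu> \<in> borel_prob T. (\<integral>x. f x \<partial>\<mu>) \<in> V} |f V. bounded_continuous_on T f \<and> open V}"
  then obtain f V where U: "U = {\<mu> \<in> borel_prob T. (\<integral>x. f x \<partial>\<mu>) \<in> V}"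
    and f: "bounded_continuous_on T f" and V: "open V"
    by blast
  have fT: "continuous_map T euclideanreal f"
    using f by (simp add: bounded_continuous_on_def)
  have int: "(\<integral>x. f x \<partial>push_forward T h \<mu>) = (\<integral>x. f (h x) \<partial>\<mu>)" if "\<mu> \<in> borel_prob S" for \<mu>
    unfolding push_forward_def
    by (rule integral_distr[OF push_forward_measurable[OF h that] borel_measurable_borel_of[OF fT]])
  have "push_forward T h -` U \<inter> topspace (weak_topology S)
      = {\<mu> \<in> borel_prob S. (\<integral>x. f (h x) \<partial>\<mu>) \<in> V}"
    using int push_forward_in_borel_prob[OF h] by (auto simp: U)
  moreover have "bounded_continuous_on S (\<lambda>x. f (h x))"
  proof -
    have "(\<lambda>x. f (h x)) ` topspace S \<subseteq> f ` topspace T"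
      using continuous_map_image_subset_topspace[OF h] by blast
    moreover have "continuous_map S euclideanreal (f \<circ> h)"
      using h fT by (rule continuous_map_compose)
    ultimately show ?thesis
      using f by (auto simp: bounded_continuous_on_def o_def intro: bounded_subset)
  qed
  ultimately show "openin (weak_topology S) (push_forward T h -` U \<inter> topspace (weak_topology S))"
    unfolding weak_topology_def using V
    by (auto intro!: topology_generated_by_Basis)
next
  show "push_forward T h ` topspace (weak_topology S)
      \<subseteq> \<Union>{{\<mu> \<in> borel_prob T. (\<integral>x. f x \<partial>\<mu>) \<in> V} |f V. bounded_continuous_on T f \<and> open V}"
    using push_forward_in_borel_prob[OF h]
    by (simp add: topology_generated_by_topspace[symmetric] weak_topology_def[symmetric] image_subset_iff)
qed

lemma homeomorphic_map_push_forward: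
  assumes "homeomorphic_maps S T h k"
  shows "homeomorphic_map (weak_topology S) (weak_topology T) (push_forward T h)"
proof -
  have "homeomorphic_maps T S k h"
    using assms by (subst homeomorphic_maps_sym)
  then have "homeomorphic_maps (weak_topology S) (weak_topology T) (push_forward T h) (push_forward S k)"
    using assms push_forward_inverse[of S T h k] push_forward_inverse[of T S k h]
    unfolding homeomorphic_maps_def[of "weak_topology S"]
    by (auto simp: homeomorphic_maps_def intro: continuous_map_push_forward)
  then show ?thesis
    by (auto simp: homeomorphic_map_maps)
qed

section \<open>The ideal of residually null sets\<close>

lemma null_measures_iff:
  assumes "A \<subseteq> topspace T"
  shows "\<mu> \<in> null_measures T A \<longleftrightarrow> \<mu> \<in> borel_prob T \<and> (\<exists>B\<in>null_sets \<mu>. A \<subseteq> B)"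
proof (intro iffI conjI)
  assume "\<mu> \<in> null_measures T A"
  then show "\<mu> \<in> borel_prob T" "\<exists>B\<in>null_sets \<mu>. A \<subseteq> B"
    using outer_measure_of_attain[of A \<mu>] assms borel_probD(3)[of \<mu> T]
    by (auto simp: null_measures_def null_sets_def)
next
  assume "\<mu> \<in> borel_prob T \<and> (\<exists>B\<in>null_sets \<mu>. A \<subseteq> B)"
  then obtain B where B: "\<mu> \<in> borel_prob T" "B \<in> sets \<mu>" "emeasure \<mu> B = 0" "A \<subseteq> B"
    by (auto simp: null_sets_def)
  then show "\<mu> \<in> null_measures T A"
    using outer_measure_of_mono[OF B(4), of \<mu>] by (simp add: null_measures_def)
qed

lemma residually_null_iff:
  "residually_null T A \<longleftrightarrow>
     A \<subseteq> topspace T \<and> meager_in (weak_topology T) (borel_prob T - null_measures T A)"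
  by (auto simp: residually_null_def comeager_in_def null_measures_def)

lemma residually_null_UN:
  assumes I: "countable I" and A: "\<And>i. i \<in> I \<Longrightarrow> residually_null T (A i)"
  shows "residually_null T (\<Union>i\<in>I. A i)"
proof -
  have sub: "A i \<subseteq> topspace T" if "i \<in> I" for i
    using A[OF that] by (simp add: residually_null_iff)
  have "\<mu> \<in> null_measures T (\<Union>i\<in>I. A i)"
    if \<mu>: "\<mu> \<in> borel_prob T" and null: "\<forall>i\<in>I. \<mu> \<in> null_measures T (A i)" for \<mu>
  proof -
    have "\<forall>i\<in>I. \<exists>B\<in>null_sets \<mu>. A i \<subseteq> B"
      using null sub by (simp add: null_measures_iff)
    then obtain B where B: "\<forall>i\<in>I. B i \<in> null_sets \<mu> \<and> A i \<subseteq> B i"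
      by metis
    then have "(\<Union>i\<in>I. B i) \<in> null_sets \<mu>"
      by (intro null_sets_UN' I) auto
    moreover have "(\<Union>i\<in>I. A i) \<subseteq> (\<Union>i\<in>I. B i)"
      using B by blast
    ultimately show ?thesis
      using \<mu> sub by (subst null_measures_iff) auto
  qed
  then have "borel_prob T - null_measures T (\<Union>i\<in>I. A i)
      \<subseteq> (\<Union>i\<in>I. borel_prob T - null_measures T (A i))"
    by blast
  moreover have "meager_in (weak_topology T) (\<Union>i\<in>I. borel_prob T - null_measures T (A i))"
    using A by (intro meager_in_UN I) (simp add: residually_null_iff)
  ultimately show ?thesis
    using sub by (auto simp: residually_null_iff intro: meager_in_subset)
qed

lemma residually_null_Un:
  assumes "residually_null T A" "residually_null T B"
  shows "residually_null T (A \<union> B)"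
  using residually_null_UN[of "{A, B}" T "\<lambda>X. X"] assms by auto

lemma residually_null_subset:
  assumes "residually_null T A" "B \<subseteq> A"
  shows "residually_null T B"
proof -
  have "null_measures T A \<subseteq> null_measures T B"
  proof
    fix \<mu> assume "\<mu> \<in> null_measures T A"
    then show "\<mu> \<in> null_measures T B"
      using outer_measure_of_mono[OF assms(2), of \<mu>] by (simp add: null_measures_def)
  qed
  then have "borel_prob T - null_measures T B \<subseteq> borel_prob T - null_measures T A"
    by blast
  then show ?thesis
    using assms by (auto simp: residually_null_iff intro: meager_in_subset)
qed

text \<open>The push-forward homeomorphism carries the co-meager set \<open>\<N>(A)\<close> into \<open>\<N>(h(A))\<close>.\<close>

lemma residually_null_homeomorphic_image:
  assumes h: "homeomorphic_map S T h" and A: "residually_null S A"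
  shows "residually_null T (h ` A)"
proof -
  obtain k where hk: "homeomorphic_maps S T h k"
    using h by (auto simp: homeomorphic_map_maps)
  then have kh: "homeomorphic_maps T S k h"
    by (subst homeomorphic_maps_sym)
  have ch: "continuous_map S T h" and ck: "continuous_map T S k"
    and inv_k: "\<And>x. x \<in> topspace S \<Longrightarrow> k (h x) = x"
    using hk by (auto simp: homeomorphic_maps_def)
  have AS: "A \<subseteq> topspace S"
    using A by (simp add: residually_null_iff)
  then have hA: "h ` A \<subseteq> topspace T"
    using homeomorphic_imp_surjective_map[OF h] by blast
  have push: "push_forward T h \<mu> \<in> null_measures T (h ` A)" if "\<mu> \<in> null_measures S A" for \<mu>
  proof -
    obtain B where \<mu>: "\<mu> \<in> borel_prob S" and B: "B \<in> null_sets \<mu>" "A \<subseteq> B"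
      using \<open>\<mu> \<in> null_measures S A\<close> AS by (auto simp: null_measures_iff)
    \<comment> \<open>The null set covering \<open>h(A)\<close> is \<open>h(B)\<close>, written as a preimage under the inverse map.\<close>
    define C where "C = k -` B \<inter> topspace T"
    have BS: "B \<subseteq> topspace S" "B \<in> sets (borel_of S)"
      using B(1) borel_probD[OF \<mu>] sets.sets_into_space[of B \<mu>] by auto
    have C: "C \<in> sets (borel_of T)"
      using measurable_sets[OF measurable_borel_of[OF ck] BS(2)] by (simp add: C_def space_borel_of)
    have "h -` C \<inter> space \<mu> = B"
      using BS(1) inv_k continuous_map_image_subset_topspace[OF ch] borel_probD(3)[OF \<mu>]
      by (auto simp: C_def image_subset_iff subset_iff)
    then have "emeasure (push_forward T h \<mu>) C = emeasure \<mu> B"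
      using emeasure_distr[OF push_forward_measurable[OF ch \<mu>] C] by (simp add: push_forward_def)
    then have "C \<in> null_sets (push_forward T h \<mu>)"
      using B(1) C by (auto simp: null_sets_def push_forward_def)
    moreover have "h ` A \<subseteq> C"
      using AS B(2) hA inv_k by (auto simp: C_def subset_iff)
    ultimately show ?thesis
      using push_forward_in_borel_prob[OF ch \<mu>] hA by (auto simp: null_measures_iff)
  qed
  have "borel_prob T - null_measures T (h ` A)
      \<subseteq> push_forward T h ` (borel_prob S - null_measures S A)"
  proof
    fix \<nu> assume \<nu>: "\<nu> \<in> borel_prob T - null_measures T (h ` A)"
    define \<mu> where "\<mu> = push_forward S k \<nu>"
    have "\<mu> \<in> borel_prob S" "push_forward T h \<mu> = \<nu>"
      using \<nu> push_forward_in_borel_prob[OF ck] push_forward_inverse[OF kh] by (auto simp: \<mu>_def)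
    then show "\<nu> \<in> push_forward T h ` (borel_prob S - null_measures S A)"
      using \<nu> push by (intro image_eqI[of _ _ \<mu>]) auto
  qed
  moreover have "meager_in (weak_topology T) (push_forward T h ` (borel_prob S - null_measures S A))"
    using A by (intro meager_in_homeomorphic_image[OF homeomorphic_map_push_forward[OF hk]])
      (simp add: residually_null_iff)
  ultimately show ?thesis
    using hA by (auto simp: residually_null_iff intro: meager_in_subset)
qed

section \<open>Translations of a topological group\<close>

context topological_group
begin

lemma homeomorphic_map_left_translation:
  assumes g: "g \<in> carrier G"
  shows "homeomorphic_map T T (\<lambda>x. g \<otimes> x)"
proof -
  have cont: "continuous_map T T (\<lambda>x. a \<otimes> x)" if "a \<in> carrier G" for a
  proof -
    have "continuous_map T (prod_topology T T) (\<lambda>x. (a, x))"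
      using that by (intro continuous_map_pairedI) (auto simp: topspace_eq_carrier)
    from continuous_map_compose[OF this continuous_mult] show ?thesis
      by (simp add: o_def)
  qed
  have "homeomorphic_maps T T (\<lambda>x. g \<otimes> x) (\<lambda>x. inv g \<otimes> x)"
    using g cont by (auto simp: homeomorphic_maps_def topspace_eq_carrier m_assoc[symmetric])
  then show ?thesis
    by (auto simp: homeomorphic_map_maps)
qed

lemma homeomorphic_map_right_translation:
  assumes g: "g \<in> carrier G"
  shows "homeomorphic_map T T (\<lambda>x. x \<otimes> g)"
proof -
  have cont: "continuous_map T T (\<lambda>x. x \<otimes> a)" if "a \<in> carrier G" for a
  proof -
    have "continuous_map T (prod_topology T T) (\<lambda>x. (x, a))"
      using that by (intro continuous_map_pairedI) (auto simp: topspace_eq_carrier)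
    from continuous_map_compose[OF this continuous_mult] show ?thesis
      by (simp add: o_def)
  qed
  have "homeomorphic_maps T T (\<lambda>x. x \<otimes> g) (\<lambda>x. x \<otimes> inv g)"
    using g cont by (auto simp: homeomorphic_maps_def topspace_eq_carrier m_assoc)
  then show ?thesis
    by (auto simp: homeomorphic_map_maps)
qed

text \<open>A point \<open>x\<close> lies in \<open>dW\<close> exactly if \<open>d\<close> lies in \<open>xW\<inverse>\<close>; the latter is open and
  nonempty, so it contains some \<open>d\<close> from any given dense set.\<close>

lemma dense_translates_cover:
  assumes D: "D \<subseteq> carrier G" "T closure_of D = topspace T"
    and W: "openin T W" "W \<noteq> {}"
  shows "carrier G \<subseteq> (\<Union>d\<in>D. (\<lambda>x. d \<otimes> x) ` W)"
proof
  fix x assume x: "x \<in> carrier G"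
  have WG: "W \<subseteq> carrier G"
    using openin_subset[OF W(1)] by (simp add: topspace_eq_carrier)
  have "continuous_map T T ((\<lambda>y. y \<otimes> x) \<circ> (\<lambda>d. inv d))"
    using continuous_inv homeomorphic_imp_continuous_map[OF homeomorphic_map_right_translation[OF x]]
    by (rule continuous_map_compose)
  then have "openin T {d \<in> topspace T. inv d \<otimes> x \<in> W}"
    using W(1) by (auto simp: continuous_map_def)
  moreover have "{d \<in> topspace T. inv d \<otimes> x \<in> W} \<noteq> {}"
  proof -
    obtain w where w: "w \<in> W" "w \<in> carrier G"
      using W(2) WG by blast
    have "inv (x \<otimes> inv w) \<otimes> x = w"
      using x w by (simp add: inv_mult_group m_assoc)
    then have "x \<otimes> inv w \<in> {d \<in> topspace T. inv d \<otimes> x \<in> W}"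
      using x w by (simp add: topspace_eq_carrier)
    then show ?thesis
      by blast
  qed
  ultimately obtain d where d: "d \<in> D" "inv d \<otimes> x \<in> W"
    using D(2) unfolding dense_intersects_open by blast
  have "x = d \<otimes> (inv d \<otimes> x)"
    using d(1) D(1) x by (simp add: m_assoc[symmetric] subset_iff)
  then show "x \<in> (\<Union>d\<in>D. (\<lambda>x. d \<otimes> x) ` W)"
    using d by blast
qed

lemma residually_null_open_imp_carrier:
  assumes sep: "separable_space T" and W: "openin T W" "W \<noteq> {}" and null: "residually_null T W"
  shows "residually_null T (carrier G)"
proof -
  obtain D where D: "countable D" "D \<subseteq> carrier G" "T closure_of D = topspace T"
    using sep by (auto simp: separable_space_def topspace_eq_carrier)
  have "residually_null T (\<Union>d\<in>D. (\<lambda>x. d \<otimes> x) ` W)"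
  proof (rule residually_null_UN[OF D(1)])
    fix d assume "d \<in> D"
    then have "d \<in> carrier G"
      using D(2) by blast
    then show "residually_null T ((\<lambda>x. d \<otimes> x) ` W)"
      using null by (intro residually_null_homeomorphic_image[OF homeomorphic_map_left_translation])
  qed
  then show ?thesis
    using dense_translates_cover[OF D(2,3) W] by (rule residually_null_subset)
qed

text \<open>The Pettis step, stated for an arbitrary self-homeomorphism so that it applies to
  left and right translations alike.\<close>

lemma meets_homeomorphic_image:
  assumes sep: "separable_space T" and A: "\<not> residually_null T A" "A \<subseteq> carrier G"
    and U: "openin T U" "residually_null T (U - A)"
    and h: "homeomorphic_map T T h" and meet: "U \<inter> h ` U \<noteq> {}"
  shows "A \<inter> h ` A \<noteq> {}"
proof
  assume disj: "A \<inter> h ` A = {}"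
  have "openin T (U \<inter> h ` U)"
    using U(1) homeomorphic_imp_open_map[OF h] by (auto simp: open_map_def)
  moreover have "residually_null T (U \<inter> h ` U)"
  proof (rule residually_null_subset)
    show "residually_null T ((U - A) \<union> h ` (U - A))"
      using U(2) h by (intro residually_null_Un residually_null_homeomorphic_image)
    show "U \<inter> h ` U \<subseteq> (U - A) \<union> h ` (U - A)"
      using disj by blast
  qed
  ultimately have "residually_null T (carrier G)"
    using meet by (intro residually_null_open_imp_carrier[OF sep])
  with A show False
    by (blast intro: residually_null_subset)
qed

end

theorem theorem41:
  fixes G (structure) and T :: "'a topology" and A :: "'a set"
  assumes "polish_group G T"
    and "A \<subseteq> carrier G"
    and "EBP_set T A"
    and "\<not> residually_null T A"
  shows "contains_nhd T \<one> {inv a \<otimes> b | a b. a \<in> A \<and> b \<in> A}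
       \<and> contains_nhd T \<one> {a \<otimes> inv b | a b. a \<in> A \<and> b \<in> A}"
proof -
  interpret polish_group G T by fact
  have sep: "separable_space T"
    using polish by (simp add: polish_topology_def)
  obtain U where U: "openin T U" "residually_null T ((U - A) \<union> (A - U))"
    using assms(3) by (auto simp: EBP_set_def)
  have UA: "residually_null T (U - A)"
    using U(2) by (rule residually_null_subset) blast
  have "U \<noteq> {}"
    using U(2) assms(4) by auto
  then obtain u where u: "u \<in> U" "u \<in> carrier G"
    using openin_subset[OF U(1)] by (auto simp: topspace_eq_carrier)
  note meets = meets_homeomorphic_image[OF sep assms(4,2) U(1) UA]
  have "contains_nhd T \<one> {inv a \<otimes> b | a b. a \<in> A \<and> b \<in> A}"
    unfolding contains_nhd_def
  proof (intro exI[of _ "{g \<in> topspace T. u \<otimes> g \<in> U}"] conjI subsetI)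
    show "openin T {g \<in> topspace T. u \<otimes> g \<in> U}"
      using homeomorphic_imp_continuous_map[OF homeomorphic_map_left_translation[OF u(2)]] U(1)
      by (auto simp: continuous_map_def)
    show "\<one> \<in> {g \<in> topspace T. u \<otimes> g \<in> U}"
      using u by (simp add: topspace_eq_carrier)
    fix g assume "g \<in> {g \<in> topspace T. u \<otimes> g \<in> U}"
    then have g: "g \<in> carrier G" "u \<otimes> g \<in> U"
      by (auto simp: topspace_eq_carrier)
    have "U \<inter> (\<lambda>x. x \<otimes> g) ` U \<noteq> {}"
      using g u by blast
    then obtain a where a: "a \<in> A" "a \<otimes> g \<in> A"
      using meets[OF homeomorphic_map_right_translation[OF g(1)]] by blast
    then have "g = inv a \<otimes> (a \<otimes> g)"
      using g(1) assms(2) by (simp add: m_assoc[symmetric] subset_iff)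
    with a show "g \<in> {inv a \<otimes> b | a b. a \<in> A \<and> b \<in> A}"
      by blast
  qed
  moreover have "contains_nhd T \<one> {a \<otimes> inv b | a b. a \<in> A \<and> b \<in> A}"
    unfolding contains_nhd_def
  proof (intro exI[of _ "{g \<in> topspace T. g \<otimes> u \<in> U}"] conjI subsetI)
    show "openin T {g \<in> topspace T. g \<otimes> u \<in> U}"
      using homeomorphic_imp_continuous_map[OF homeomorphic_map_right_translation[OF u(2)]] U(1)
      by (auto simp: continuous_map_def)
    show "\<one> \<in> {g \<in> topspace T. g \<otimes> u \<in> U}"
      using u by (simp add: topspace_eq_carrier)
    fix g assume "g \<in> {g \<in> topspace T. g \<otimes> u \<in> U}"
    then have g: "g \<in> carrier G" "g \<otimes> u \<in> U"
      by (auto simp: topspace_eq_carrier)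
    have "U \<inter> (\<lambda>x. g \<otimes> x) ` U \<noteq> {}"
      using g u by blast
    then obtain b where b: "b \<in> A" "g \<otimes> b \<in> A"
      using meets[OF homeomorphic_map_left_translation[OF g(1)]] by blast
    then have "g = (g \<otimes> b) \<otimes> inv b"
      using g(1) assms(2) by (simp add: m_assoc subset_iff)
    with b show "g \<in> {a \<otimes> inv b | a b. a \<in> A \<and> b \<in> A}"
      by blast
  qed
  ultimately show ?thesis ..
qed

end
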